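(* Let $K \subset \mathbb{R}^2$ be a triangle. Let $X, X'$ be independent uniformly distributed random points in $K$ and $Y, Y'$ independent uniformly distributed random points on $\partial K$. Then for every direction $u$, $$\mathbb{E}|P_u(X) - P_u(X')| \le \mathbb{E}|P_u(Y) - P_u(Y')|.$$ In particular, $\Delta(K) \le \theta(K)$, where $\Delta(K) = \mathbb{E}|XX'|$ and $\theta(K) = \mathbb{E}|YY'|$.
   Context: A triangle means a non-degenerate (full-dimensional) closed triangle. "Uniform in $K$" is with respect to Lebesgue measure; "uniform on $\partial K$" is with respect to arc length. A direction $u$ is a unit vector, and $P_u$ is the orthogonal projection onto the direction $u$, $P_u(Z) = \langle Z, u\rangle$. $|AB|$ denotes Euclidean distance. *)

theory Defs
  imports "HOL-Analysis.Analysis" "HOL-Probability.Probability"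
begin

definition proj :: "real^2 \<Rightarrow> real^2 \<Rightarrow> real" where
  "proj u z = z \<bullet> u"

text \<open>
  The arc length measure carried by a piecewise continuously differentiable path \<open>g\<close>:
  the image under \<open>g\<close> of the measure \<open>\<bar>g'(t)\<bar> dt\<close> on \<open>[0,1]\<close>. If \<open>g\<close> is simple, a Borel set is
  assigned the length of the part of the curve that it contains.
\<close>

definition arc_length_measure :: "(real \<Rightarrow> 'a::euclidean_space) \<Rightarrow> 'a measure" where
  "arc_length_measure g =
     distr (density (restrict_space lborel {0..1})
              (\<lambda>t. ennreal (norm (vector_derivative g (at t within {0..1})))))
       borel g"

definition triangle_path :: "'a::real_normed_vector \<Rightarrow> 'a \<Rightarrow> 'a \<Rightarrow> real \<Rightarrow> 'a" where
  "triangle_path a b c = linepath a b +++ linepath b c +++ linepath c a"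

definition uniform_in :: "'a::euclidean_space set \<Rightarrow> 'a measure" where
  "uniform_in K = uniform_measure lborel K"

definition uniform_on_boundary :: "real^2 \<Rightarrow> real^2 \<Rightarrow> real^2 \<Rightarrow> (real^2) measure" where
  "uniform_on_boundary a b c =
     uniform_measure (arc_length_measure (triangle_path a b c)) (frontier (convex hull {a, b, c}))"

lemma path_image_triangle_path:
  fixes a b c :: "real^2"
  shows "path_image (triangle_path a b c) = frontier (convex hull {a, b, c})"
  by (simp add: triangle_path_def path_image_join frontier_of_triangle Un_assoc)

lemma triangle_path_derivative:
  fixes a b c :: "'a::euclidean_space"
  assumes "t \<in> {0<..<1}" "t \<noteq> 1/2" "t \<noteq> 3/4"
  shows "vector_derivative (triangle_path a b c) (at t within {0..1}) =
    (if t < 1/2 then 2 *\<^sub>R (b - a) else if t < 3/4 then 4 *\<^sub>R (c - b) else 4 *\<^sub>R (a - c))"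
    (is "_ = ?D")
proof -
  have at: "at t within {0..1} = at t"
    using assms by (intro at_within_interior) auto
  have "(triangle_path a b c has_vector_derivative ?D) (at t)"
  proof -
    consider (1) "t < 1/2" | (2) "1/2 < t" "t < 3/4" | (3) "3/4 < t"
      using assms by linarith
    then show ?thesis
    proof cases
      case 1
      have "((\<lambda>x. (1 - 2*x) *\<^sub>R a + (2*x) *\<^sub>R b) has_vector_derivative ?D) (at t)"
        using 1 by (auto intro!: derivative_eq_intros simp: algebra_simps)
      then show ?thesis
        by (rule has_vector_derivative_transform_within_open[where S = "{..<1/2}"])
           (use 1 in \<open>auto simp: triangle_path_def joinpaths_def linepath_def\<close>)
    next
      case 2
      have "((\<lambda>x. (1 - 2*(2*x-1)) *\<^sub>R b + (2*(2*x-1)) *\<^sub>R c) has_vector_derivative ?D) (at t)"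
        using 2 by (auto intro!: derivative_eq_intros simp: algebra_simps)
      then show ?thesis
        by (rule has_vector_derivative_transform_within_open[where S = "{1/2<..<3/4}"])
           (use 2 in \<open>auto simp: triangle_path_def joinpaths_def linepath_def\<close>)
    next
      case 3
      have "((\<lambda>x. (1 - (2*(2*x-1)-1)) *\<^sub>R c + (2*(2*x-1)-1) *\<^sub>R a) has_vector_derivative ?D) (at t)"
        using 3 by (auto intro!: derivative_eq_intros simp: algebra_simps)
      then show ?thesis
        by (rule has_vector_derivative_transform_within_open[where S = "{3/4<..}"])
           (use 3 in \<open>auto simp: triangle_path_def joinpaths_def linepath_def\<close>)
    qed
  qed
  then show ?thesis
    unfolding at by (rule vector_derivative_at)
qed

lemma emeasure_arc_length_triangle:
  fixes a b c :: "real^2"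
  shows "emeasure (arc_length_measure (triangle_path a b c)) (frontier (convex hull {a, b, c})) =
    ennreal (dist a b + dist b c + dist c a)"
proof -
  let ?g = "triangle_path a b c"
  let ?R = "restrict_space lborel {0..1::real}"
  let ?f = "\<lambda>t. ennreal (norm (vector_derivative ?g (at t within {0..1})))"
  let ?h = "\<lambda>t::real. ennreal (2 * dist a b) * indicator {0..1/2} t +
      ennreal (4 * dist b c) * indicator {1/2..3/4} t + ennreal (4 * dist c a) * indicator {3/4..1} t"
  let ?S = "{0, 1/2, 3/4, 1} :: real set"
  have path: "path ?g"
    by (simp add: triangle_path_def)
  have gm: "?g \<in> measurable (density ?R ?f) borel"
    using borel_measurable_continuous_on_restrict[OF path[unfolded path_def]]
    by (simp cong: measurable_cong_sets add: sets_restrict_space)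
  have eq: "?f t = ?h t" if "t \<in> {0..1}" "t \<notin> ?S" for t
    using that triangle_path_derivative[of t a b c]
    by (auto simp: dist_norm norm_minus_commute indicator_def)
  have pre: "?g -` frontier (convex hull {a, b, c}) \<inter> {0..1} = {0..1}"
    by (auto simp flip: path_image_triangle_path simp: path_image_def)
  have fm: "?f \<in> borel_measurable ?R"
  proof -
    have "(\<lambda>t. if t \<in> ?S then ?f t else ?h t) \<in> borel_measurable ?R"
    proof (rule measurable_discrete_difference[where X = ?S and f = ?h])
      show "?h \<in> borel_measurable ?R"
        by (intro measurable_restrict_space1) measurable
    qed (auto simp: sets_restrict_space)
    then show ?thesis
      by (rule measurable_cong[THEN iffD1, rotated]) (use eq in auto)
  qed
  have "emeasure (arc_length_measure ?g) (frontier (convex hull {a, b, c})) =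
      emeasure (density ?R ?f) {0..1}"
    unfolding arc_length_measure_def
    by (subst emeasure_distr[OF gm]) (auto simp: pre)
  also have "\<dots> = (\<integral>\<^sup>+ t. ?f t * indicator {0..1} t \<partial>?R)"
    by (rule emeasure_density[OF fm]) (auto simp: sets_restrict_space)
  also have "\<dots> = (\<integral>\<^sup>+ t. ?f t * indicator {0..1} t \<partial>lborel)"
    by (subst nn_integral_restrict_space) (auto intro!: nn_integral_cong split: split_indicator)
  also have "\<dots> = (\<integral>\<^sup>+ t. ?h t \<partial>lborel)"
  proof (rule nn_integral_cong_AE)
    have "AE t in lborel. t \<notin> ?S"
      by (intro AE_not_in finite_imp_null_set_lborel) auto
    then show "AE t in lborel. ?f t * indicator {0..1} t = ?h t"
    proof eventually_elim
      case (elim t)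
      then show ?case
        using eq[of t] by (cases "t \<in> {0..1}") (auto simp: indicator_def)
    qed
  qed
  also have "\<dots> = ennreal (2 * dist a b) * ennreal (1/2) +
      ennreal (4 * dist b c) * ennreal (1/4) + ennreal (4 * dist c a) * ennreal (1/4)"
    by (simp add: nn_integral_add nn_integral_cmult)
  also have "\<dots> = ennreal (dist a b + dist b c + dist c a)"
    by (simp only: ennreal_mult'[symmetric] ennreal_plus[symmetric] zero_le_dist
          mult_nonneg_nonneg add_nonneg_nonneg zero_le_numeral zero_le_divide_1_iff) simp
  finally show ?thesis .
qed

end

theory Submission
  imports Defs
begin

text \<open>
  For a real random variable with distribution function \<open>F\<close>, two independent copies have mean absolute
  difference \<open>2 \<integral> F (1 - F)\<close>. Let \<open>p \<le> q \<le> r\<close> be the projections of the vertices and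
  \<open>s = (q - p) / (r - p)\<close>. Projecting the uniform distribution on the triangle gives a tent density on
  \<open>[p, r]\<close> with peak at \<open>q\<close>, hence \<open>\<integral> F (1 - F) = (r - p) (2 - s (1 - s)) / 15\<close>. Projecting the
  boundary gives a mixture of the uniform distributions on \<open>[p, q]\<close>, \<open>[q, r]\<close>, \<open>[p, r]\<close> with weights
  \<open>\<alpha>, \<beta>, w\<close>; its distribution function depends on them only through its value \<open>\<kappa> = w s + \<alpha>\<close> at \<open>q\<close>,
  and \<open>\<integral> F (1 - F) = (r - p) (1/6 - s (1 - s) / 12 + (\<kappa> - s/2) ((1 + s)/2 - \<kappa>) / 3)\<close>. By the triangle
  inequality each of \<open>\<alpha>, \<beta>\<close> is at most \<open>1/2\<close>, so the last product is nonnegative. Averaging the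
  projections over all directions recovers the Euclidean distance.
\<close>

subsection \<open>Mean absolute differences and averages over directions\<close>

text \<open>The distance between two reals is the length of the set of levels t that separate them.
  By Tonelli the left side is the integral over t of the probability that t separates two
  independent copies; this can happen in two orders, each of probability
  \<open>F t * (1 - F t)\<close>.\<close>

lemma (in prob_space) nn_integral_abs_diff_eq_cdf:
  assumes [measurable]: "f \<in> borel_measurable M"
  defines "F \<equiv> \<lambda>t::real. prob {x \<in> space M. f x \<le> t}"
  shows "(\<integral>\<^sup>+x. \<integral>\<^sup>+y. ennreal \<bar>f x - f y\<bar> \<partial>M \<partial>M) = (\<integral>\<^sup>+t. ennreal (2 * (F t * (1 - F t))) \<partial>lborel)"
proof -
  note fst_int = nn_integral_fst and times_emeasure = emeasure_pair_measure_Times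
  interpret pair_sigma_finite M M ..
  interpret P: pair_prob_space M M ..
  interpret L: pair_sigma_finite "M \<Otimes>\<^sub>M M" lborel ..
  \<comment> \<open>At most one of the two intervals is nonempty. Half-open intervals match the
    events \<open>f x \<le> t\<close> and \<open>t < f x\<close> exactly, so atoms of the
    distribution cause no error.\<close>
  let ?i = "\<lambda>z t. indicator {f (fst z)..<f (snd z)} t + indicator {f (snd z)..<f (fst z)} t :: ennreal"
  have le: "{x \<in> space M. f x \<le> t} \<in> events" and gt: "{x \<in> space M. t < f x} \<in> events" for t
    by measurable
  have pgt: "prob {x \<in> space M. t < f x} = 1 - F t" for t
  proof -
    have "{x \<in> space M. t < f x} = space M - {x \<in> space M. f x \<le> t}" by auto
    then show ?thesis using prob_compl[OF le[of t]] by (simp add: F_def)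
  qed
  have "(\<integral>\<^sup>+x. \<integral>\<^sup>+y. ennreal \<bar>f x - f y\<bar> \<partial>M \<partial>M) = (\<integral>\<^sup>+z. ennreal \<bar>f (fst z) - f (snd z)\<bar> \<partial>(M \<Otimes>\<^sub>M M))"
    using fst_int[of "\<lambda>z. ennreal \<bar>f (fst z) - f (snd z)\<bar>" M] by simp
  also have "\<dots> = (\<integral>\<^sup>+z. \<integral>\<^sup>+t. ?i z t \<partial>lborel \<partial>(M \<Otimes>\<^sub>M M))"
  proof (rule nn_integral_cong)
    fix z show "ennreal \<bar>f (fst z) - f (snd z)\<bar> = (\<integral>\<^sup>+t. ?i z t \<partial>lborel)"
      by (cases "f (fst z) \<le> f (snd z)") (auto simp: nn_integral_add)
  qed
  also have "\<dots> = (\<integral>\<^sup>+t. \<integral>\<^sup>+z. ?i z t \<partial>(M \<Otimes>\<^sub>M M) \<partial>lborel)"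
  proof (rule L.Fubini'[symmetric])
    have "case_prod ?i = (\<lambda>w. (if f (fst (fst w)) \<le> snd w \<and> snd w < f (snd (fst w)) then 1 else 0) +
        (if f (snd (fst w)) \<le> snd w \<and> snd w < f (fst (fst w)) then 1 else 0))"
      by (simp add: fun_eq_iff indicator_def)
    then show "case_prod ?i \<in> borel_measurable ((M \<Otimes>\<^sub>M M) \<Otimes>\<^sub>M lborel)"
      by simp
  qed
  also have "\<dots> = (\<integral>\<^sup>+t. ennreal (2 * (F t * (1 - F t))) \<partial>lborel)"
  proof (rule nn_integral_cong)
    fix t
    let ?A = "{x \<in> space M. f x \<le> t}" and ?B = "{x \<in> space M. t < f x}"
    have "(\<integral>\<^sup>+z. ?i z t \<partial>(M \<Otimes>\<^sub>M M)) =
        (\<integral>\<^sup>+z. indicator (?A \<times> ?B) z + indicator (?B \<times> ?A) z \<partial>(M \<Otimes>\<^sub>M M))"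
      by (intro nn_integral_cong) (auto simp: space_pair_measure split: split_indicator)
    also have "\<dots> = emeasure M ?A * emeasure M ?B + emeasure M ?B * emeasure M ?A"
      using le gt by (subst nn_integral_add) (auto simp: times_emeasure)
    also have "\<dots> = ennreal (2 * (F t * (1 - F t)))"
    proof -
      have "0 \<le> F t" "0 \<le> 1 - F t"
        using pgt[of t, symmetric] by (simp_all add: F_def)
      then have "ennreal (F t) * ennreal (1 - F t) + ennreal (1 - F t) * ennreal (F t) =
          ennreal (F t * (1 - F t) + (1 - F t) * F t)"
        by (subst ennreal_plus) (simp_all only: ennreal_mult mult_nonneg_nonneg)
      also have "F t * (1 - F t) + (1 - F t) * F t = 2 * (F t * (1 - F t))" by simp
      finally show ?thesis
        unfolding emeasure_eq_measure pgt by (simp only: F_def)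
    qed
    finally show "(\<integral>\<^sup>+z. ?i z t \<partial>(M \<Otimes>\<^sub>M M)) = ennreal (2 * (F t * (1 - F t)))" .
  qed
  finally show ?thesis .
qed

text \<open>With \<phi> the polar angle of z, the integrand is
  \<open>norm z * \<bar>cos (\<theta> - \<phi>)\<bar>\<close>, and the absolute cosine has integral
  2 over any interval of length pi. Half a turn covers all directions up to sign.\<close>

lemma nn_integral_abs_inner_circle:
  fixes z :: "real^2"
  shows "(\<integral>\<^sup>+\<theta>. ennreal \<bar>z \<bullet> vector [cos \<theta>, sin \<theta>]\<bar> * indicator {0..pi} \<theta> \<partial>lborel) = ennreal (2 * norm z)"
proof -
  \<comment> \<open>With a nonnegative first coordinate, \<phi> is an arcsine in [-pi/2, pi/2], so
    on [0, pi] the cosine of \<theta> - \<phi> can change sign only at \<phi> + pi/2. The other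
    half-plane follows from z -> -z.\<close>
  have *: "(\<integral>\<^sup>+\<theta>. ennreal \<bar>z \<bullet> vector [cos \<theta>, sin \<theta>]\<bar> * indicator {0..pi} \<theta> \<partial>lborel) = ennreal (2 * norm z)"
    if z1: "z $ 1 \<ge> 0" and z0: "z \<noteq> 0" for z :: "real^2"
  proof -
    define r where "r = norm z"
    define \<phi> where "\<phi> = arcsin (z $ 2 / r)"
    have r: "r > 0" and r2: "r\<^sup>2 = (z $ 1)\<^sup>2 + (z $ 2)\<^sup>2"
      using z0 by (simp_all add: r_def) (simp add: norm_vec_def L2_set_def sum_2)
    have le: "- 1 \<le> z $ 2 / r" "z $ 2 / r \<le> 1"
      using component_le_norm_cart[of z 2] r by (simp_all add: r_def abs_le_iff divide_simps)
    have \<phi>: "-(pi/2) \<le> \<phi>" "\<phi> \<le> pi/2"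
      unfolding \<phi>_def using arcsin_lbound[OF le] arcsin_ubound[OF le] by auto
    have s: "z $ 2 = r * sin \<phi>"
      unfolding \<phi>_def using le r by (subst sin_arcsin) auto
    have "cos \<phi> = z $ 1 / r"
    proof (rule power2_eq_imp_eq)
      show "(cos \<phi>)\<^sup>2 = (z $ 1 / r)\<^sup>2"
        using r r2 unfolding cos_squared_eq s by (simp add: field_simps)
    qed (use r z1 \<phi> cos_ge_zero in auto)
    with r have c: "z $ 1 = r * cos \<phi>" by simp
    have eq: "\<bar>z \<bullet> vector [cos \<theta>, sin \<theta>]\<bar> = r * \<bar>cos (\<theta> - \<phi>)\<bar>" for \<theta>
    proof -
      have "z \<bullet> vector [cos \<theta>, sin \<theta>] = r * cos (\<theta> - \<phi>)"
        by (simp add: inner_vec_def sum_2 c s cos_diff algebra_simps)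
      then show ?thesis using r by (simp add: abs_mult)
    qed
    \<comment> \<open>The two pieces contribute r + r sin \<phi> and r - r sin \<phi>.\<close>
    have 1: "((\<lambda>\<theta>. r * \<bar>cos (\<theta> - \<phi>)\<bar>) has_integral r * sin (\<phi> + pi/2 - \<phi>) - r * sin (0 - \<phi>)) {0..\<phi> + pi/2}"
    proof (rule fundamental_theorem_of_calculus)
      fix \<theta> assume "\<theta> \<in> {0..\<phi> + pi/2}"
      then have "cos (\<theta> - \<phi>) \<ge> 0" using \<phi> by (intro cos_ge_zero) auto
      then show "((\<lambda>\<theta>. r * sin (\<theta> - \<phi>)) has_vector_derivative r * \<bar>cos (\<theta> - \<phi>)\<bar>) (at \<theta> within {0..\<phi> + pi/2})"
        by (auto intro!: derivative_eq_intros simp: has_real_derivative_iff_has_vector_derivative[symmetric])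
    qed (use \<phi> in auto)
    have 2: "((\<lambda>\<theta>. r * \<bar>cos (\<theta> - \<phi>)\<bar>) has_integral (- r * sin (pi - \<phi>)) - (- r * sin (\<phi> + pi/2 - \<phi>))) {\<phi> + pi/2..pi}"
    proof (rule fundamental_theorem_of_calculus)
      fix \<theta> assume "\<theta> \<in> {\<phi> + pi/2..pi}"
      then have "cos (pi - (\<theta> - \<phi>)) \<ge> 0" using \<phi> by (intro cos_ge_zero) auto
      then have "cos (\<theta> - \<phi>) \<le> 0" by simp
      then show "((\<lambda>\<theta>. - r * sin (\<theta> - \<phi>)) has_vector_derivative r * \<bar>cos (\<theta> - \<phi>)\<bar>) (at \<theta> within {\<phi> + pi/2..pi})"
        by (auto intro!: derivative_eq_intros simp: has_real_derivative_iff_has_vector_derivative[symmetric])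
    qed (use \<phi> in auto)
    have "((\<lambda>\<theta>. r * \<bar>cos (\<theta> - \<phi>)\<bar>) has_integral 2 * r) {0..pi}"
      using has_integral_combine[OF _ _ 1 2] \<phi> by simp
    then have "(\<integral>\<^sup>+\<theta>. ennreal (r * \<bar>cos (\<theta> - \<phi>)\<bar>) * indicator {0..pi} \<theta> \<partial>lborel) = ennreal (2 * r)"
      using r by (intro nn_integral_has_integral_lebesgue') auto
    then show ?thesis unfolding eq r_def .
  qed
  show ?thesis
  proof (cases "z = 0")
    case False
    then show ?thesis
      using *[of z] *[of "- z"] by (cases "z $ 1 \<ge> 0") auto
  qed simp
qed

subsection \<open>The one-dimensional inequality\<close>

text \<open>Contribution to 2 \<integral> F (1 - F) of a stretch on which F grows linearly from 0.
  The last hypothesis keeps F at most 1, hence the integrand nonnegative and untouched by the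
  truncation in \<open>ennreal\<close>.\<close>

lemma nn_integral_linear_cdf_piece:
  fixes l p q :: real
  assumes "p \<le> q" "0 \<le> l" "l * (q - p) \<le> 1"
  shows "(\<integral>\<^sup>+t. ennreal (2 * (l * (t - p) * (1 - l * (t - p)))) * indicator {p..q} t \<partial>lborel) =
    ennreal (2 * (l * (q - p)^2 / 2 - l^2 * (q - p)^3 / 3))"
proof (rule nn_integral_has_integral_lebesgue')
  fix t assume t: "t \<in> {p..q}"
  then have "l * (t - p) \<le> l * (q - p)" using assms by (intro mult_left_mono) auto
  then show "0 \<le> 2 * (l * (t - p) * (1 - l * (t - p)))" using assms t by auto
next
  have "((\<lambda>t. 2 * (l * (t - p) * (1 - l * (t - p)))) has_integral
     2 * (l * (q - p)^2 / 2 - l^2 * (q - p)^3 / 3) - 2 * (l * (p - p)^2 / 2 - l^2 * (p - p)^3 / 3)) {p..q}"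
    by (rule fundamental_theorem_of_calculus)
       (use assms in \<open>auto intro!: derivative_eq_intros simp: has_real_derivative_iff_has_vector_derivative[symmetric] field_simps power2_eq_square\<close>)
  then show "((\<lambda>t. 2 * (l * (t - p) * (1 - l * (t - p)))) has_integral
     2 * (l * (q - p)^2 / 2 - l^2 * (q - p)^3 / 3)) {p..q}" by simp
qed

lemma nn_integral_quadratic_cdf_piece:
  fixes l p q :: real
  assumes "p \<le> q" "0 \<le> l" "l * (q - p)^2 \<le> 1"
  shows "(\<integral>\<^sup>+t. ennreal (2 * (l * (t - p)^2 * (1 - l * (t - p)^2))) * indicator {p..q} t \<partial>lborel) =
    ennreal (2 * (l * (q - p)^3 / 3 - l^2 * (q - p)^5 / 5))"
proof (rule nn_integral_has_integral_lebesgue')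
  fix t assume t: "t \<in> {p..q}"
  then have "l * (t - p)^2 \<le> l * (q - p)^2" using assms by (intro mult_left_mono power_mono) auto
  then show "0 \<le> 2 * (l * (t - p)^2 * (1 - l * (t - p)^2))" using assms t by auto
next
  have "((\<lambda>t. 2 * (l * (t - p)^2 * (1 - l * (t - p)^2))) has_integral
     2 * (l * (q - p)^3 / 3 - l^2 * (q - p)^5 / 5) - 2 * (l * (p - p)^3 / 3 - l^2 * (p - p)^5 / 5)) {p..q}"
    by (rule fundamental_theorem_of_calculus)
       (use assms in \<open>auto intro!: derivative_eq_intros simp: has_real_derivative_iff_has_vector_derivative[symmetric] field_simps eval_nat_numeral\<close>)
  then show "((\<lambda>t. 2 * (l * (t - p)^2 * (1 - l * (t - p)^2))) has_integral
     2 * (l * (q - p)^3 / 3 - l^2 * (q - p)^5 / 5)) {p..q}" by simp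
qed

text \<open>Reflection turns a stretch ending at r, where the upper tail 1 - F is a monomial in r -
  t, into one starting at -r, where the formulas above apply, since F (1 - F) is symmetric in F and
  1 - F.\<close>

lemma nn_integral_reflect_piece:
  fixes q r :: real
  assumes [measurable]: "f \<in> borel_measurable borel"
  shows "(\<integral>\<^sup>+t. f t * indicator {q..r} t \<partial>lborel) = (\<integral>\<^sup>+t. f (- t) * indicator {-r..-q} t \<partial>lborel)"
  by (subst nn_integral_real_affine[where c = "-1" and t = 0])
     (auto intro!: nn_integral_cong split: split_indicator)

lemma nn_integral_linear_cdf_piece':
  fixes l q r :: real
  assumes "q \<le> r" "0 \<le> l" "l * (r - q) \<le> 1"
  shows "(\<integral>\<^sup>+t. ennreal (2 * ((1 - l * (r - t)) * (l * (r - t)))) * indicator {q..r} t \<partial>lborel) =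
    ennreal (2 * (l * (r - q)^2 / 2 - l^2 * (r - q)^3 / 3))"
  using nn_integral_linear_cdf_piece[of "-r" "-q" l] assms
  by (subst nn_integral_reflect_piece) (simp_all add: algebra_simps)

lemma nn_integral_quadratic_cdf_piece':
  fixes l q r :: real
  assumes "q \<le> r" "0 \<le> l" "l * (r - q)^2 \<le> 1"
  shows "(\<integral>\<^sup>+t. ennreal (2 * ((1 - l * (r - t)^2) * (l * (r - t)^2))) * indicator {q..r} t \<partial>lborel) =
    ennreal (2 * (l * (r - q)^3 / 3 - l^2 * (r - q)^5 / 5))"
  using nn_integral_quadratic_cdf_piece[of "-r" "-q" l] assms
  by (subst nn_integral_reflect_piece) (simp_all add: algebra_simps)

text \<open>Both integrals split at q into monomial pieces and become polynomials in s and \<kappa>.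
  The cases p = q and q = r are included, since two vertices may have the same projection. The
  weight conditions say that \<alpha> and \<beta> are at most 1/2.\<close>

lemma nn_integral_tent_cdf_le:
  fixes p q r \<alpha> \<beta> w :: real
  assumes num: "p \<le> q" "q \<le> r" "p < r"
    "0 \<le> \<alpha>" "0 \<le> \<beta>" "0 \<le> w" "\<alpha> \<le> \<beta> + w" "\<beta> \<le> \<alpha> + w" "\<alpha> + \<beta> + w = 1"
    and F: "\<And>t. t < p \<Longrightarrow> F t = 0" "\<And>t. r < t \<Longrightarrow> F t = 1"
      "\<And>t. p < t \<Longrightarrow> t < q \<Longrightarrow> F t = (t - p)^2 / ((q - p) * (r - p))"
      "\<And>t. q < t \<Longrightarrow> t < r \<Longrightarrow> 1 - F t = (r - t)^2 / ((r - q) * (r - p))"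
    and G: "\<And>t. p < t \<Longrightarrow> t < q \<Longrightarrow> G t = (w / (r - p) + \<alpha> / (q - p)) * (t - p)"
      "\<And>t. q < t \<Longrightarrow> t < r \<Longrightarrow> 1 - G t = (w / (r - p) + \<beta> / (r - q)) * (r - t)"
  shows "(\<integral>\<^sup>+t. ennreal (2 * (F t * (1 - F t))) \<partial>lborel) \<le> (\<integral>\<^sup>+t. ennreal (2 * (G t * (1 - G t))) \<partial>lborel)"
proof -
  define d e D where "d = q - p" and "e = r - q" and "D = r - p"
  have D: "D > 0" "d \<ge> 0" "e \<ge> 0" and De: "D = d + e" using num by (auto simp: d_def e_def D_def)
  define s where "s = d / D"
  have s: "0 \<le> s" "s \<le> 1" and sd: "d = s * D" "e = (1 - s) * D"
    using D De by (auto simp: s_def field_simps)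
  define \<kappa> where "\<kappa> = w * s + \<alpha>"
  have k': "1 - \<kappa> = w * (1 - s) + \<beta>" using num by (simp add: \<kappa>_def algebra_simps)
  define F1 F2 G1 G2 where "F1 = 1 / (d * D)" and "F2 = 1 / (e * D)"
    and "G1 = w / D + \<alpha> / d" and "G2 = w / D + \<beta> / e"
  \<comment> \<open>If d or e is zero, division by zero turns the corresponding coefficients into 0
    or \<open>w / D\<close>. Multiplied by powers of d or e they vanish, and so do the closed forms
    on the right.\<close>
  have eqs: "F1 * d^3 = D * s^2" "F1^2 * d^5 = D * s^3" "F2 * e^3 = D * (1 - s)^2" "F2^2 * e^5 = D * (1 - s)^3"
    "G1 * d^2 = D * s * \<kappa>" "G1^2 * d^3 = D * s * \<kappa>^2"
    "G2 * e^2 = D * (1 - s) * (1 - \<kappa>)" "G2^2 * e^3 = D * (1 - s) * (1 - \<kappa>)^2"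
  proof -
    have 1: "G1 * d = (if d = 0 then 0 else \<kappa>)" "G2 * e = (if e = 0 then 0 else 1 - \<kappa>)"
      using D unfolding k' G1_def G2_def sd unfolding \<kappa>_def by (auto simp: field_simps)
    have 2: "F1 * d^2 = (if d = 0 then 0 else s)" "F2 * e^2 = (if e = 0 then 0 else 1 - s)"
      using D unfolding F1_def F2_def sd by (auto simp: field_simps power2_eq_square)
    have "F1 * d^3 = F1 * d^2 * d"
      by (simp add: eval_nat_numeral)
    also have "\<dots> = D * s^2"
      unfolding 2(1) using D(1) unfolding sd by (auto simp: power2_eq_square power3_eq_cube)
    finally show "F1 * d^3 = D * s^2" .
    have "F1^2 * d^5 = (F1 * d^2)^2 * d"
      by (simp add: eval_nat_numeral)
    also have "\<dots> = D * s^3"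
      unfolding 2(1) using D(1) unfolding sd by (auto simp: power2_eq_square power3_eq_cube)
    finally show "F1^2 * d^5 = D * s^3" .
    have "F2 * e^3 = F2 * e^2 * e"
      by (simp add: eval_nat_numeral)
    also have "\<dots> = D * (1 - s)^2"
      unfolding 2(2) using D(1) unfolding sd by (auto simp: power2_eq_square power3_eq_cube)
    finally show "F2 * e^3 = D * (1 - s)^2" .
    have "F2^2 * e^5 = (F2 * e^2)^2 * e"
      by (simp add: eval_nat_numeral)
    also have "\<dots> = D * (1 - s)^3"
      unfolding 2(2) using D(1) unfolding sd by (auto simp: power2_eq_square power3_eq_cube)
    finally show "F2^2 * e^5 = D * (1 - s)^3" .
    have "G1 * d^2 = G1 * d * d"
      by (simp add: eval_nat_numeral)
    also have "\<dots> = D * s * \<kappa>"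
      unfolding 1(1) using D(1) unfolding sd by (auto simp: power2_eq_square power3_eq_cube)
    finally show "G1 * d^2 = D * s * \<kappa>" .
    have "G1^2 * d^3 = (G1 * d)^2 * d"
      by (simp add: eval_nat_numeral)
    also have "\<dots> = D * s * \<kappa>^2"
      unfolding 1(1) using D(1) unfolding sd by (auto simp: power2_eq_square power3_eq_cube)
    finally show "G1^2 * d^3 = D * s * \<kappa>^2" .
    have "G2 * e^2 = G2 * e * e"
      by (simp add: eval_nat_numeral)
    also have "\<dots> = D * (1 - s) * (1 - \<kappa>)"
      unfolding 1(2) using D(1) unfolding sd by (auto simp: power2_eq_square power3_eq_cube)
    finally show "G2 * e^2 = D * (1 - s) * (1 - \<kappa>)" .
    have "G2^2 * e^3 = (G2 * e)^2 * e"
      by (simp add: eval_nat_numeral)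
    also have "\<dots> = D * (1 - s) * (1 - \<kappa>)^2"
      unfolding 1(2) using D(1) unfolding sd by (auto simp: power2_eq_square power3_eq_cube)
    finally show "G2^2 * e^3 = D * (1 - s) * (1 - \<kappa>)^2" .
  qed
  \<comment> \<open>Makes each piece of the integral for F nonnegative, so that the sum may be
    formed inside \<open>ennreal\<close>.\<close>
  have cube: "x^3 / 5 \<le> x^2 / 3" if "0 \<le> x" "x \<le> 1" for x :: real
    proof -
    have "x^3 \<le> x^2" using that by (intro power_decreasing) auto
    with that show ?thesis using zero_le_power2[of x] by linarith
  qed
  \<comment> \<open>Here w + \<alpha> = 1 - \<beta> is at least 1/2, and s \<le> 1 gives (w +
    \<alpha>) s \<le> w s + \<alpha> = \<kappa>. The mirrored argument bounds 1 - \<kappa> from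
    below.\<close>
  have "s / 2 \<le> (w + \<alpha>) * s" using mult_right_mono[of "1/2" "w + \<alpha>" s] s num by simp
  also have "\<dots> \<le> \<kappa>" using mult_left_mono[of s 1 \<alpha>] s num by (simp add: \<kappa>_def algebra_simps)
  finally have k1: "s / 2 \<le> \<kappa>" .
  have "(1 - s) / 2 \<le> (w + \<beta>) * (1 - s)" using mult_right_mono[of "1/2" "w + \<beta>" "1 - s"] s num by simp
  also have "\<dots> \<le> 1 - \<kappa>" using mult_left_mono[of "1 - s" 1 \<beta>] s num unfolding k' by (simp add: algebra_simps)
  finally have k2: "\<kappa> \<le> (1 + s) / 2" by (simp add: field_simps)
  have nonneg: "0 \<le> F1" "0 \<le> F2" "0 \<le> G1" "0 \<le> G2"
    using D num by (auto simp: F1_def F2_def G1_def G2_def)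
  have AE: "AE t in lborel. t \<notin> {p, q, r}"
    by (intro AE_not_in finite_imp_null_set_lborel) auto
  have "(\<integral>\<^sup>+t. ennreal (2 * (F t * (1 - F t))) \<partial>lborel) =
    (\<integral>\<^sup>+t. ennreal (2 * (F1 * (t - p)^2 * (1 - F1 * (t - p)^2))) * indicator {p..q} t +
          ennreal (2 * ((1 - F2 * (r - t)^2) * (F2 * (r - t)^2))) * indicator {q..r} t \<partial>lborel)"
  proof (rule nn_integral_cong_AE)
    show "AE t in lborel. ennreal (2 * (F t * (1 - F t))) =
      ennreal (2 * (F1 * (t - p)^2 * (1 - F1 * (t - p)^2))) * indicator {p..q} t +
          ennreal (2 * ((1 - F2 * (r - t)^2) * (F2 * (r - t)^2))) * indicator {q..r} t"
      using AE
    proof eventually_elim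
      case (elim t)
      then consider "t < p" | "p < t" "t < q" | "q < t" "t < r" | "r < t" by force
      then show ?case
      proof cases
        case 3
        have "F t = 1 - F2 * (r - t)^2"
          using F(4)[OF 3] by (simp add: F2_def e_def D_def)
        with 3 num show ?thesis by simp
      qed (use F num in \<open>auto simp: F1_def d_def D_def\<close>)
    qed
  qed
  also have "\<dots> = ennreal (2 * (F1 * d^3 / 3 - F1^2 * d^5 / 5)) + ennreal (2 * (F2 * e^3 / 3 - F2^2 * e^5 / 5))"
  proof -
    have "F1 * (q - p)^2 \<le> 1" "F2 * (r - q)^2 \<le> 1"
      using D De num by (auto simp: F1_def F2_def d_def[symmetric] e_def[symmetric] power2_eq_square divide_simps)
    then show ?thesis
      using num nonneg by (simp add: nn_integral_add nn_integral_quadratic_cdf_piece nn_integral_quadratic_cdf_piece' d_def e_def)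
  qed
  also have "\<dots> = ennreal (2 * (F1 * d^3 / 3 - F1^2 * d^5 / 5 + (F2 * e^3 / 3 - F2^2 * e^5 / 5)))"
  proof -
    have "F1 * d^3 / 3 - F1^2 * d^5 / 5 \<ge> 0"
      using mult_left_mono[OF cube[of s], of D] s D unfolding eqs by (simp add: algebra_simps)
    moreover have "F2 * e^3 / 3 - F2^2 * e^5 / 5 \<ge> 0"
      using mult_left_mono[OF cube[of "1 - s"], of D] s D unfolding eqs by (simp add: right_diff_distrib)
    ultimately show ?thesis by (simp add: ennreal_plus[symmetric] del: ennreal_plus)
  qed
  also have "\<dots> \<le> ennreal (2 * (G1 * d^2 / 2 - G1^2 * d^3 / 3 + (G2 * e^2 / 2 - G2^2 * e^3 / 3)))"
  proof -
    \<comment> \<open>Difference of the two closed forms: 1/30 = 1/6 - 2/15 and 1/60 = 1/12 - 1/15.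
      The crude bound s (1 - s) \<le> 1 already makes the first two terms together positive.\<close>
    have "D * s * \<kappa> / 2 - D * s * \<kappa>^2 / 3 + (D * (1 - s) * (1 - \<kappa>) / 2 - D * (1 - s) * (1 - \<kappa>)^2 / 3) -
       (D * s^2 / 3 - D * s^3 / 5 + (D * (1 - s)^2 / 3 - D * (1 - s)^3 / 5))
       = D * (1 / 30 - s * (1 - s) / 60 + (\<kappa> - s / 2) * ((1 + s) / 2 - \<kappa>) / 3)"
      by (simp add: field_simps eval_nat_numeral)
    moreover have "D * (1 / 30 - s * (1 - s) / 60 + (\<kappa> - s / 2) * ((1 + s) / 2 - \<kappa>) / 3) \<ge> 0"
    proof -
      have arith: "0 \<le> 1 / 30 - x / 60 + y / 3" if "x \<le> 1" "0 \<le> y" for x y :: real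
        using that by linarith
      have "s * (1 - s) \<le> 1 * 1" using s by (intro mult_mono) auto
      moreover have "0 \<le> (\<kappa> - s / 2) * ((1 + s) / 2 - \<kappa>)" using k1 k2 by simp
      ultimately show ?thesis 
        using D(1) arith[of "s * (1 - s)" "(\<kappa> - s / 2) * ((1 + s) / 2 - \<kappa>)"] by simp
    qed
    ultimately show ?thesis unfolding eqs by (intro ennreal_leI) simp
  qed
  also have "\<dots> \<le> ennreal (2 * (G1 * d^2 / 2 - G1^2 * d^3 / 3)) + ennreal (2 * (G2 * e^2 / 2 - G2^2 * e^3 / 3))"
  proof -
    have *: "x^2 / 3 \<le> x / 2" if "0 \<le> x" "x \<le> 1" for x :: real
      using mult_right_mono[OF \<open>x \<le> 1\<close>, of x] that unfolding power2_eq_square by linarith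
    have "G1 * d^2 / 2 - G1^2 * d^3 / 3 \<ge> 0"
      using mult_left_mono[OF *[of \<kappa>], of "D * s"] k1 k2 s D unfolding eqs by (simp add: algebra_simps)
    moreover have "G2 * e^2 / 2 - G2^2 * e^3 / 3 \<ge> 0"
      using mult_left_mono[OF *[of "1 - \<kappa>"], of "D * (1 - s)"] k1 k2 s D unfolding eqs by simp
    ultimately show ?thesis by (simp add: ennreal_plus[symmetric] del: ennreal_plus)
  qed
  also have "\<dots> = 
    (\<integral>\<^sup>+t. ennreal (2 * (G1 * (t - p) * (1 - G1 * (t - p)))) * indicator {p..q} t +
          ennreal (2 * ((1 - G2 * (r - t)) * (G2 * (r - t)))) * indicator {q..r} t \<partial>lborel)"
  proof -
    have "G1 * (q - p) \<le> 1" "G2 * (r - q) \<le> 1"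
    proof -
      have "G1 * d = (if d = 0 then 0 else \<kappa>)" "G2 * e = (if e = 0 then 0 else 1 - \<kappa>)"
        using D unfolding k' G1_def G2_def sd unfolding \<kappa>_def by (auto simp: field_simps)
      then show "G1 * (q - p) \<le> 1" "G2 * (r - q) \<le> 1"
        using k1 k2 s unfolding d_def[symmetric] e_def[symmetric] by auto
    qed
    then show ?thesis
      using num nonneg by (simp add: nn_integral_add nn_integral_linear_cdf_piece nn_integral_linear_cdf_piece' d_def e_def)
  qed
  \<comment> \<open>G is prescribed only inside the two open intervals. Outside [p, r] the left
    integrand is 0 and the right one is nonnegative in \<open>ennreal\<close>, so an inequality is
    enough.\<close>
  also have "\<dots> \<le> (\<integral>\<^sup>+t. ennreal (2 * (G t * (1 - G t))) \<partial>lborel)"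
  proof (rule nn_integral_mono_AE)
    show "AE t in lborel. 
      ennreal (2 * (G1 * (t - p) * (1 - G1 * (t - p)))) * indicator {p..q} t +
          ennreal (2 * ((1 - G2 * (r - t)) * (G2 * (r - t)))) * indicator {q..r} t 
       \<le> ennreal (2 * (G t * (1 - G t)))"
      using AE
    proof eventually_elim
      case (elim t)
      then consider "t < p" | "p < t" "t < q" | "q < t" "t < r" | "r < t" by force
      then show ?case
      proof cases
        case 3
        have "G t = 1 - G2 * (r - t)"
          using G(2)[OF 3] by (simp add: G2_def e_def D_def)
        with 3 num show ?thesis by simp
      qed (use G(1) num in \<open>auto simp: G1_def d_def D_def\<close>)
    qed
  qed
  finally show ?thesis .
qed

subsection \<open>The uniform distribution in a triangle\<close>

text \<open>Area is half the absolute determinant of the two edge vectors at a, and this is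
  homogeneous in each of them.\<close>

lemma content_triangle_corner:
  fixes a b c :: "real^2"
  assumes "0 \<le> l" "0 \<le> m"
  shows "measure lborel (convex hull {a, a + l *\<^sub>R (b - a), a + m *\<^sub>R (c - a)}) = l * m * measure lborel (convex hull {a, b, c})"
proof -
  have "(m * (c $ 1 - a $ 1)) * (l * (b $ 2 - a $ 2)) - (l * (b $ 1 - a $ 1)) * (m * (c $ 2 - a $ 2)) =
    (l * m) * ((c $ 1 - a $ 1) * (b $ 2 - a $ 2) - (b $ 1 - a $ 1) * (c $ 2 - a $ 2))"
    by (simp add: algebra_simps)
  then show ?thesis
    using assms by (simp add: content_triangle abs_mult)
qed

text \<open>For z = a + v (b - a) + w (c - a) the half-space condition reads
  \<open>v * d + w * e \<le> y\<close>. As y is at most d and at most e, this already implies v + w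
  \<le> 1, and what remains is the corner at a whose other vertices are the points at level t on the
  two edges.\<close>

lemma triangle_Int_halfspace_le:
  fixes a b c u :: "'a::euclidean_space"
  assumes "a \<bullet> u < t" "t \<le> b \<bullet> u" "t \<le> c \<bullet> u"
  shows "convex hull {a, b, c} \<inter> {z. z \<bullet> u \<le> t} =
    convex hull {a, a + ((t - a \<bullet> u) / (b \<bullet> u - a \<bullet> u)) *\<^sub>R (b - a), a + ((t - a \<bullet> u) / (c \<bullet> u - a \<bullet> u)) *\<^sub>R (c - a)}"
    (is "_ = ?R")
proof -
  define y d e where "y = t - a \<bullet> u" and "d = b \<bullet> u - a \<bullet> u" and "e = c \<bullet> u - a \<bullet> u"
  have pos: "0 < y" "0 < d" "0 < e" "y \<le> d" "y \<le> e" using assms by (auto simp: y_def d_def e_def)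
  have iff: "a + v *\<^sub>R (b - a) + w *\<^sub>R (c - a) \<in> {z. z \<bullet> u \<le> t} \<longleftrightarrow> v * d + w * e \<le> y" for v w
    by (auto simp: inner_add_left inner_diff_left y_def d_def e_def)
  show ?thesis
  proof (intro subset_antisym subsetI)
    fix z assume z: "z \<in> convex hull {a, b, c} \<inter> {z. z \<bullet> u \<le> t}"
    then obtain v w where vw: "z = a + v *\<^sub>R (b - a) + w *\<^sub>R (c - a)" "0 \<le> v" "0 \<le> w"
      by (auto simp: convex_hull_3_alt)
    then have le: "v * d + w * e \<le> y" using z iff[of v w] by auto
    \<comment> \<open>The coordinates of z with respect to the shortened edges.\<close>
    have "z = a + (v * d / y) *\<^sub>R ((a + (y / d) *\<^sub>R (b - a)) - a) + (w * e / y) *\<^sub>R ((a + (y / e) *\<^sub>R (c - a)) - a)"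
      using pos by (simp add: vw)
    moreover have "0 \<le> v * d / y" "0 \<le> w * e / y" "v * d / y + w * e / y \<le> 1"
      using pos vw le by (simp_all add: add_divide_distrib[symmetric])
    ultimately show "z \<in> ?R"
      unfolding convex_hull_3_alt y_def[symmetric] d_def[symmetric] e_def[symmetric] by blast
  next
    fix z assume "z \<in> ?R"
    then obtain v w where vw: "z = a + v *\<^sub>R ((a + (y / d) *\<^sub>R (b - a)) - a) + w *\<^sub>R ((a + (y / e) *\<^sub>R (c - a)) - a)"
        "0 \<le> v" "0 \<le> w" "v + w \<le> 1"
      unfolding convex_hull_3_alt y_def[symmetric] d_def[symmetric] e_def[symmetric] by blast
    have z: "z = a + (v * (y / d)) *\<^sub>R (b - a) + (w * (y / e)) *\<^sub>R (c - a)"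
      by (simp add: vw)
    have "v * (y / d) \<le> v * 1" "w * (y / e) \<le> w * 1"
      using pos vw by (intro mult_left_mono; simp)+
    then have "v * (y / d) + w * (y / e) \<le> 1" using vw by simp
    moreover have "0 \<le> v * (y / d)" "0 \<le> w * (y / e)" using pos vw by simp_all
    ultimately have "z \<in> convex hull {a, b, c}" unfolding convex_hull_3_alt z by blast
    moreover have "v * (y / d) * d + w * (y / e) * e \<le> y"
      using pos mult_right_mono[OF \<open>v + w \<le> 1\<close>, of y] by (simp add: algebra_simps)
    ultimately show "z \<in> convex hull {a, b, c} \<inter> {z. z \<bullet> u \<le> t}"
      using iff unfolding z by blast
  qed
qed

lemma compact_triangle: "compact (convex hull {a, b, c :: 'a::euclidean_space})"
  by (intro finite_imp_compact_convex_hull) auto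

lemma emeasure_triangle: "emeasure lborel (convex hull {a, b, c :: 'a::euclidean_space}) = ennreal (measure lborel (convex hull {a, b, c}))"
  using emeasure_compact_finite[OF compact_triangle[of a b c]] by (simp add: emeasure_eq_ennreal_measure)

lemma content_triangle_pos:
  fixes a b c :: "real^2"
  assumes "\<not> collinear {a, b, c}"
  shows "0 < measure lborel (convex hull {a, b, c})"
proof -
  \<comment> \<open>The centroid, with all weights 1/3, is an interior point.\<close>
  have "interior (convex hull {a, b, c}) \<noteq> {}"
    using interior_convex_hull_3_minimal[OF assms] by (auto intro!: exI[of _ "1/3"])
  then show ?thesis
    using negligible_convex_interior[of "convex hull {a, b, c}"] compact_imp_closed[OF compact_triangle[of a b c]]
    by (auto simp: negligible_iff_null_sets null_sets_completion_iff null_sets_def emeasure_triangle zero_less_measure_iff less_le)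
qed

lemma prob_space_uniform_in_triangle:
  fixes a b c :: "real^2"
  assumes "\<not> collinear {a, b, c}"
  shows "prob_space (uniform_in (convex hull {a, b, c}))"
  unfolding uniform_in_def
  using content_triangle_pos[OF assms] by (intro prob_space_uniform_measure) (auto simp: emeasure_triangle)

lemma measure_uniform_in_triangle:
  fixes a b c :: "real^2"
  assumes "\<not> collinear {a, b, c}" "B \<in> sets borel"
  shows "measure (uniform_in (convex hull {a, b, c})) B = measure lborel (convex hull {a, b, c} \<inter> B) / measure lborel (convex hull {a, b, c})"
  unfolding uniform_in_def
  using content_triangle_pos[OF assms(1)] assms(2) by (subst measure_uniform_measure) (auto simp: emeasure_triangle)

text \<open>The corner keeps the fractions
  \<open>(t - a \<bullet> u) / (b \<bullet> u - a \<bullet> u)\<close> and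
  \<open>(t - a \<bullet> u) / (c \<bullet> u - a \<bullet> u)\<close> of the edges at a, and the
  ratio of areas is their product.\<close>

lemma uniform_in_triangle_corner:
  fixes a b c u :: "real^2"
  assumes "\<not> collinear {a, b, c}" "a \<bullet> u < t" "t \<le> b \<bullet> u" "t \<le> c \<bullet> u"
  shows "measure (uniform_in (convex hull {a, b, c})) {z. z \<bullet> u \<le> t} = (t - a \<bullet> u)^2 / ((b \<bullet> u - a \<bullet> u) * (c \<bullet> u - a \<bullet> u))"
proof -
  have B: "{z. z \<bullet> u \<le> t} \<in> sets borel" by measurable
  show ?thesis
    unfolding measure_uniform_in_triangle[OF assms(1) B] triangle_Int_halfspace_le[OF assms(2-4)]
    using assms content_triangle_pos[OF assms(1)] by (subst content_triangle_corner) (auto simp: power2_eq_square)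
qed

text \<open>A line has area zero. This is for passing to upper tails: the complement of a closed
  half-plane is open, while the corner formula speaks of closed ones.\<close>

lemma uniform_in_triangle_strict_halfspace:
  fixes a b c u :: "real^2"
  assumes "\<not> collinear {a, b, c}" "u \<noteq> 0"
  shows "measure (uniform_in (convex hull {a, b, c})) {z. z \<bullet> u < t} = measure (uniform_in (convex hull {a, b, c})) {z. z \<bullet> u \<le> t}"
proof -
  interpret prob_space "uniform_in (convex hull {a, b, c})" by (rule prob_space_uniform_in_triangle[OF assms(1)])
  have [simp]: "sets (uniform_in (convex hull {a, b, c})) = sets borel" by (simp add: uniform_in_def)
  have null: "{z. u \<bullet> z = t} \<in> null_sets lborel"
    using negligible_hyperplane[of u t] assms(2) by (simp add: negligible_iff_null_sets null_sets_completion_iff)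
  have "convex hull {a, b, c} \<inter> {z. z \<bullet> u = t} \<in> null_sets lborel"
  proof (rule null_sets_subset[OF null])
    show "convex hull {a, b, c} \<inter> {z. z \<bullet> u = t} \<in> sets lborel"
      using compact_imp_closed[OF compact_triangle[of a b c]] by simp
  qed (auto simp: inner_commute)
  then have "measure lborel (convex hull {a, b, c} \<inter> {z. z \<bullet> u = t}) = 0"
    by (simp add: measure_eq_0_null_sets)
  then have "prob {z. z \<bullet> u = t} = 0"
    by (subst measure_uniform_in_triangle[OF assms(1)]) auto
  moreover have "prob {z. z \<bullet> u \<le> t} = prob {z. z \<bullet> u < t} + prob {z. z \<bullet> u = t}"
    by (subst finite_measure_Union[symmetric]) (auto intro!: arg_cong[where f = prob])
  ultimately show ?thesis by simp
qed

text \<open>Below the middle vertex the cut is the corner at a. Above it the complement of the cut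
  is the corner at c, so the tail 1 - F comes from the same formula with u and t negated.\<close>

lemma uniform_in_triangle_cdf:
  fixes a b c u :: "real^2"
  defines "F \<equiv> \<lambda>t. measure (uniform_in (convex hull {a, b, c})) {z. z \<bullet> u \<le> t}"
  assumes nc: "\<not> collinear {a, b, c}" and u: "u \<noteq> 0" and le: "a \<bullet> u \<le> b \<bullet> u" "b \<bullet> u \<le> c \<bullet> u"
  shows "t < a \<bullet> u \<Longrightarrow> F t = 0" "c \<bullet> u < t \<Longrightarrow> F t = 1"
      "a \<bullet> u < t \<Longrightarrow> t < b \<bullet> u \<Longrightarrow> F t = (t - a \<bullet> u)^2 / ((b \<bullet> u - a \<bullet> u) * (c \<bullet> u - a \<bullet> u))"
      "b \<bullet> u < t \<Longrightarrow> t < c \<bullet> u \<Longrightarrow> 1 - F t = (c \<bullet> u - t)^2 / ((c \<bullet> u - b \<bullet> u) * (c \<bullet> u - a \<bullet> u))"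
proof -
  let ?K = "convex hull {a, b, c}"
  interpret prob_space "uniform_in ?K" by (rule prob_space_uniform_in_triangle[OF nc])
  have [simp]: "sets (uniform_in ?K) = sets borel" "space (uniform_in ?K) = UNIV" by (simp_all add: uniform_in_def)
  have K: "a \<bullet> u \<le> z \<bullet> u" "z \<bullet> u \<le> c \<bullet> u" if "z \<in> ?K" for z
  proof -
    have "?K \<subseteq> {z. a \<bullet> u \<le> z \<bullet> u} \<inter> {z. z \<bullet> u \<le> c \<bullet> u}"
      using le by (intro hull_minimal convex_Int) (auto simp: inner_commute[of _ u] convex_halfspace_le convex_halfspace_ge)
    with that show "a \<bullet> u \<le> z \<bullet> u" "z \<bullet> u \<le> c \<bullet> u" by auto
  qed
  show "F t = 0" if "t < a \<bullet> u"
  proof -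
    have "?K \<inter> {z. z \<bullet> u \<le> t} = {}" using K that by force
    then show ?thesis unfolding F_def by (subst measure_uniform_in_triangle[OF nc]) auto
  qed
  show "F t = 1" if "c \<bullet> u < t"
  proof -
    have "?K \<inter> {z. z \<bullet> u \<le> t} = ?K" using K that by force
    then show ?thesis unfolding F_def using content_triangle_pos[OF nc]
      by (subst measure_uniform_in_triangle[OF nc]) auto
  qed
  show "F t = (t - a \<bullet> u)^2 / ((b \<bullet> u - a \<bullet> u) * (c \<bullet> u - a \<bullet> u))" if "a \<bullet> u < t" "t < b \<bullet> u"
    unfolding F_def using that le by (intro uniform_in_triangle_corner[OF nc]) auto
  show "1 - F t = (c \<bullet> u - t)^2 / ((c \<bullet> u - b \<bullet> u) * (c \<bullet> u - a \<bullet> u))" if t: "b \<bullet> u < t" "t < c \<bullet> u"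
  proof -
    have perm: "{c, b, a} = {a, b, c}" by auto
    have "1 - F t = prob (space (uniform_in ?K) - {z. z \<bullet> u \<le> t})"
      unfolding F_def by (subst prob_compl) auto
    also have "space (uniform_in ?K) - {z. z \<bullet> u \<le> t} = {z. z \<bullet> (- u) < - t}" by auto
    also have "prob \<dots> = prob {z. z \<bullet> (- u) \<le> - t}"
      using u by (intro uniform_in_triangle_strict_halfspace[OF nc]) simp
    also have "\<dots> = (- t - c \<bullet> - u)^2 / ((b \<bullet> - u - c \<bullet> - u) * (a \<bullet> - u - c \<bullet> - u))"
      using uniform_in_triangle_corner[of c b a "- u" "- t"] nc t le unfolding perm by simp
    also have "\<dots> = (c \<bullet> u - t)^2 / ((c \<bullet> u - b \<bullet> u) * (c \<bullet> u - a \<bullet> u))"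
      by simp
    finally show ?thesis .
  qed
qed

subsection \<open>The uniform distribution on the boundary of a triangle\<close>

lemma borel_measurable_linepath [measurable]: "linepath a b \<in> borel_measurable borel"
  by (intro borel_measurable_continuous_onI continuous_on_linepath)

lemma sets_linepath_vimage:
  assumes "A \<in> sets borel"
  shows "{s \<in> {0..1}. linepath a b s \<in> A} \<in> sets borel"
proof -
  have "linepath a b -` A \<inter> space borel \<in> sets borel"
    using borel_measurable_linepath assms by (rule measurable_sets)
  then have "(linepath a b -` A \<inter> space borel) \<inter> {0..1} \<in> sets borel"
    by (rule sets.Int) simp
  also have "(linepath a b -` A \<inter> space borel) \<inter> {0..1} = {s \<in> {0..1}. linepath a b s \<in> A}"
    by auto
  finally show ?thesis .
qed

text \<open>Substitution for one side of the path: m is its length and k the factor by which its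
  parameter is sped up, so k m is the speed of the path there.\<close>

lemma nn_integral_indicator_affine:
  fixes k :: real
  assumes "S \<in> sets borel" "0 < k" "0 \<le> m"
  shows "(\<integral>\<^sup>+t. ennreal (k * m) * indicator S (d + k * t) \<partial>lborel) = ennreal m * emeasure lborel S"
proof -
  have [measurable]: "S \<in> sets borel" by fact
  have "emeasure lborel S = (\<integral>\<^sup>+t. indicator S t \<partial>lborel)" using assms by simp
  also have "\<dots> = ennreal k * (\<integral>\<^sup>+t. indicator S (d + k * t) \<partial>lborel)"
    using assms by (subst nn_integral_real_affine[where c = k and t = d]) auto
  finally have "ennreal m * emeasure lborel S = ennreal (k * m) * (\<integral>\<^sup>+t. indicator S (d + k * t) \<partial>lborel)"
    using assms by (simp add: ennreal_mult mult_ac)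
  also have "\<dots> = (\<integral>\<^sup>+t. ennreal (k * m) * indicator S (d + k * t) \<partial>lborel)"
    by (rule nn_integral_cmult[symmetric]) simp
  finally show ?thesis by simp
qed

lemma sets_arc_length_measure [simp]: "sets (arc_length_measure g) = sets borel"
  by (simp add: arc_length_measure_def)

lemma triangle_path_simps:
  assumes "t \<in> {0<..<1}" "t \<noteq> 1/2" "t \<noteq> 3/4"
  shows "triangle_path a b c t =
    (if t < 1/2 then linepath a b (2 * t) else if t < 3/4 then linepath b c (4 * t - 2) else linepath c a (4 * t - 3))"
  using assms by (auto simp: triangle_path_def joinpaths_def algebra_simps)

text \<open>Each side contributes its length times the share of its parameter interval that lands in
  A. Sides that meet or overlap need no correction, because the measure is a pushforward from the
  parameter interval.\<close>

lemma emeasure_arc_length_triangle_path: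
  fixes a b c :: "real^2"
  assumes A: "A \<in> sets borel"
  shows "emeasure (arc_length_measure (triangle_path a b c)) A =
    ennreal (dist a b) * emeasure lborel {s \<in> {0..1}. linepath a b s \<in> A} +
    ennreal (dist b c) * emeasure lborel {s \<in> {0..1}. linepath b c s \<in> A} +
    ennreal (dist c a) * emeasure lborel {s \<in> {0..1}. linepath c a s \<in> A}"
proof -
  let ?g = "triangle_path a b c"
  let ?R = "restrict_space lborel {0..1::real}"
  let ?f = "\<lambda>t. ennreal (norm (vector_derivative ?g (at t within {0..1})))"
  let ?h = "\<lambda>t::real. ennreal (2 * dist a b) * indicator {0..1/2} t +
      ennreal (4 * dist b c) * indicator {1/2..3/4} t + ennreal (4 * dist c a) * indicator {3/4..1} t"
  let ?I = "\<lambda>a b. {s \<in> {0..1}. linepath a b s \<in> A}"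
  \<comment> \<open>The joined path runs through ab on [0, 1/2], bc on [1/2, 3/4] and ca on
    [3/4, 1], hence the factors 2, 4, 4 and the shifts 0, -2, -3.\<close>
  let ?k = "\<lambda>t::real. ennreal (2 * dist a b) * indicator (?I a b) (0 + 2 * t) +
      ennreal (4 * dist b c) * indicator (?I b c) (- 2 + 4 * t) + ennreal (4 * dist c a) * indicator (?I c a) (- 3 + 4 * t)"
  let ?S = "{0, 1/2, 3/4, 1} :: real set"
  have "path ?g"
    by (simp add: triangle_path_def)
  then have gm0: "?g \<in> measurable ?R borel"
    using borel_measurable_continuous_on_restrict[of "{0..1}" ?g]
    by (simp cong: measurable_cong_sets add: sets_restrict_space path_def)
  then have gm: "?g \<in> measurable (density ?R ?f) borel"
    by (simp cong: measurable_cong_sets)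
  have eq: "?f t = ?h t" if "t \<in> {0..1}" "t \<notin> ?S" for t
    using that triangle_path_derivative[of t a b c]
    by (auto simp: dist_norm norm_minus_commute indicator_def)
  \<comment> \<open>The speed is known only off the finite set \<open>?S\<close>, and changing a
    function at finitely many points preserves measurability.\<close>
  have fm: "?f \<in> borel_measurable ?R"
  proof -
    have "(\<lambda>t. if t \<in> ?S then ?f t else ?h t) \<in> borel_measurable ?R"
    proof (rule measurable_discrete_difference[where X = ?S and f = ?h])
      show "?h \<in> borel_measurable ?R"
        by (intro measurable_restrict_space1) measurable
    qed (auto simp: sets_restrict_space)
    then show ?thesis
      by (rule measurable_cong[THEN iffD1, rotated]) (use eq in auto)
  qed
  have pre: "?g -` A \<inter> {0..1} \<in> sets ?R"
    using measurable_sets[OF gm0 A] by (simp add: space_restrict_space)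
  have "emeasure (arc_length_measure ?g) A = emeasure (density ?R ?f) (?g -` A \<inter> {0..1})"
    unfolding arc_length_measure_def
    by (subst emeasure_distr[OF gm A]) (simp add: space_restrict_space)
  also have "\<dots> = (\<integral>\<^sup>+ t. ?f t * indicator (?g -` A \<inter> {0..1}) t \<partial>?R)"
    by (rule emeasure_density[OF fm pre])
  also have "\<dots> = (\<integral>\<^sup>+ t. ?f t * indicator (?g -` A \<inter> {0..1}) t \<partial>lborel)"
    by (subst nn_integral_restrict_space) (auto intro!: nn_integral_cong split: split_indicator)
  also have "\<dots> = (\<integral>\<^sup>+ t. ?k t \<partial>lborel)"
  proof (rule nn_integral_cong_AE)
    have "AE t in lborel. t \<notin> ?S"
      by (intro AE_not_in finite_imp_null_set_lborel) auto
    then show "AE t in lborel. ?f t * indicator (?g -` A \<inter> {0..1}) t = ?k t"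
    proof eventually_elim
      case (elim t)
      show ?case
      proof (cases "t \<in> {0..1}")
        case True
        have "4 * t - 2 = - 2 + 4 * t" "4 * t - 3 = - 3 + 4 * t" by simp_all
        then show ?thesis
          using True elim eq[OF True elim] triangle_path_simps[of t a b c]
          by (auto simp: indicator_def)
      qed (auto simp: indicator_def)
    qed
  qed
  also have "\<dots> = (\<integral>\<^sup>+ t. ennreal (2 * dist a b) * indicator (?I a b) (0 + 2 * t) \<partial>lborel) +
      (\<integral>\<^sup>+ t. ennreal (4 * dist b c) * indicator (?I b c) (- 2 + 4 * t) \<partial>lborel) +
      (\<integral>\<^sup>+ t. ennreal (4 * dist c a) * indicator (?I c a) (- 3 + 4 * t) \<partial>lborel)"
  proof -
    have "(\<lambda>t. ennreal m * indicator S (d + k * t)) \<in> borel_measurable lborel"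
      if [measurable]: "S \<in> sets borel" for S :: "real set" and m d k
      by measurable
    note M = this[OF sets_linepath_vimage[OF A]]
    show ?thesis
      by (simp only: nn_integral_add M borel_measurable_add)
  qed
  also have "\<dots> = ennreal (dist a b) * emeasure lborel (?I a b) +
    ennreal (dist b c) * emeasure lborel (?I b c) + ennreal (dist c a) * emeasure lborel (?I c a)"
    by (simp only: nn_integral_indicator_affine sets_linepath_vimage[OF A] zero_less_numeral zero_le_dist)
  finally show ?thesis .
qed

text \<open>Distribution function of a uniform random point of the segment with end points p and q.
  Measuring parameters instead of points covers p > q and the point mass at p = q by the same
  formula.\<close>

definition segment_cdf :: "real \<Rightarrow> real \<Rightarrow> real \<Rightarrow> real" where
  "segment_cdf p q t = measure lborel {s \<in> {0..1}. (1 - s) * p + s * q \<le> t}"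

lemma segment_cdf_eq_0: "t < p \<Longrightarrow> t < q \<Longrightarrow> segment_cdf p q t = 0"
proof -
  assume "t < p" "t < q"
  have "t < (1 - s) * p + s * q" if "s \<in> {0..1}" for s
    using convex_bound_lt[of "- p" "- t" "- q" "1 - s" s] \<open>t < p\<close> \<open>t < q\<close> that by (simp add: algebra_simps)
  then have *: "{s \<in> {0..1}. (1 - s) * p + s * q \<le> t} = {}" by force
  show ?thesis unfolding segment_cdf_def * by simp
qed

lemma segment_cdf_eq_1: "p \<le> t \<Longrightarrow> q \<le> t \<Longrightarrow> segment_cdf p q t = 1"
proof -
  assume "p \<le> t" "q \<le> t"
  have "(1 - s) * p + s * q \<le> t" if "s \<in> {0..1}" for s
    using convex_bound_le[OF \<open>p \<le> t\<close> \<open>q \<le> t\<close>, of "1 - s" s] that by simp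
  then have *: "{s \<in> {0..1}. (1 - s) * p + s * q \<le> t} = {0..1}" by force
  show ?thesis unfolding segment_cdf_def * by simp
qed

text \<open>The substitution s -> 1 - s reverses the segment.\<close>

lemma segment_cdf_commute: "segment_cdf p q t = segment_cdf q p t"
proof -
  have 1: "{s \<in> {0..1}. (1 - s) * p + s * q \<le> t} \<in> sets borel" by measurable
  have "emeasure lborel {s \<in> {0..1}. (1 - s) * p + s * q \<le> t} = (\<integral>\<^sup>+s. indicator {s \<in> {0..1}. (1 - s) * p + s * q \<le> t} s \<partial>lborel)"
    using 1 by simp
  also have "\<dots> = (\<integral>\<^sup>+s. indicator {s \<in> {0..1}. (1 - s) * p + s * q \<le> t} (1 + (-1) * s) \<partial>lborel)"
    using 1 by (subst nn_integral_real_affine[where c = "-1" and t = 1]) auto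
  also have "\<dots> = (\<integral>\<^sup>+s. indicator {s \<in> {0..1}. (1 - s) * q + s * p \<le> t} s \<partial>lborel)"
    by (intro nn_integral_cong) (auto simp: indicator_def algebra_simps)
  also have "\<dots> = emeasure lborel {s \<in> {0..1}. (1 - s) * q + s * p \<le> t}"
    by (intro nn_integral_indicator) measurable
  finally show ?thesis by (simp add: segment_cdf_def measure_def)
qed

lemma segment_cdf_between:
  assumes "p < t" "t < q"
  shows "segment_cdf p q t = (t - p) / (q - p)"
proof -
  have *: "{s \<in> {0..1}. (1 - s) * p + s * q \<le> t} = {0..(t - p) / (q - p)}"
  proof (intro set_eqI iffI)
    fix s assume "s \<in> {0..(t - p) / (q - p)}"
    then have s: "0 \<le> s" "s * (q - p) \<le> t - p" using assms by (auto simp: field_simps)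
    have "s \<le> (t - p) / (q - p)" "(t - p) / (q - p) \<le> 1"
      using s assms by (auto simp: field_simps)
    then have "s \<le> 1" by linarith
    with s show "s \<in> {s \<in> {0..1}. (1 - s) * p + s * q \<le> t}" by (auto simp: algebra_simps)
  qed (use assms in \<open>auto simp: field_simps\<close>)
  show ?thesis unfolding segment_cdf_def * using assms by simp
qed

text \<open>The path behind \<open>uniform_on_boundary\<close> depends on the order of the vertices.
  This mixture of the side distributions makes the law of the projection visibly independent of
  it.\<close>

definition boundary_cdf :: "real^2 \<Rightarrow> real^2 \<Rightarrow> real^2 \<Rightarrow> real^2 \<Rightarrow> real \<Rightarrow> real" where
  "boundary_cdf a b c u t =
    (dist a b * segment_cdf (a \<bullet> u) (b \<bullet> u) t + dist b c * segment_cdf (b \<bullet> u) (c \<bullet> u) t +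
     dist c a * segment_cdf (c \<bullet> u) (a \<bullet> u) t) / (dist a b + dist b c + dist c a)"

text \<open>Rotation and reversal generate all six orders of the vertices, so these may later be
  sorted by projection.\<close>

lemma boundary_cdf_rotate: "boundary_cdf a b c = boundary_cdf b c a"
  by (simp add: boundary_cdf_def fun_eq_iff add_ac)

lemma boundary_cdf_swap: "boundary_cdf a b c = boundary_cdf c b a"
  by (simp add: boundary_cdf_def fun_eq_iff add_ac dist_commute segment_cdf_commute)

lemma sets_uniform_on_boundary: "sets (uniform_on_boundary a b c) = sets borel"
  by (simp add: uniform_on_boundary_def)

context
  fixes a b c :: "real^2"
  assumes nc: "\<not> collinear {a, b, c}"
begin

lemma perimeter_pos: "0 < dist a b + dist b c + dist c a"
proof -
  have "a \<noteq> b" using nc by auto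
  then show ?thesis by (simp add: add_pos_nonneg)
qed

lemma sets_frontier_triangle: "frontier (convex hull {a, b, c}) \<in> sets borel"
  by (intro borel_closed frontier_closed)

lemma prob_space_uniform_on_boundary: "prob_space (uniform_on_boundary a b c)"
  unfolding uniform_on_boundary_def
  using perimeter_pos
  by (intro prob_space_uniform_measure)
     (simp_all only: emeasure_arc_length_triangle ennreal_eq_0_iff not_le ennreal_neq_top infinity_ennreal_def simp_thms)

lemma AE_uniform_on_boundary: "AE z in uniform_on_boundary a b c. z \<in> convex hull {a, b, c}"
proof -
  have "AE z in uniform_on_boundary a b c. z \<in> frontier (convex hull {a, b, c})"
    unfolding uniform_on_boundary_def using sets_frontier_triangle
    by (intro AE_uniform_measureI) auto
  moreover have "frontier (convex hull {a, b, c}) \<subseteq> convex hull {a, b, c}"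
    by (intro frontier_subset_closed compact_imp_closed finite_imp_compact_convex_hull) auto
  ultimately show ?thesis by (auto elim: eventually_mono)
qed

text \<open>Every side lies in the frontier, so intersecting with the frontier loses nothing, and
  the projection of a \<open>linepath\<close> interpolates the projected end points linearly. Hence
  each side contributes its length times its \<open>segment_cdf\<close>.\<close>

lemma uniform_on_boundary_cdf: "measure (uniform_on_boundary a b c) {z. z \<bullet> u \<le> t} = boundary_cdf a b c u t"
proof -
  let ?F = "frontier (convex hull {a, b, c})" and ?H = "{z. z \<bullet> u \<le> t}"
  let ?m = "arc_length_measure (triangle_path a b c)"
  have nn: "0 \<le> segment_cdf x y t" for x y
    by (simp add: segment_cdf_def)
  have H: "?H \<in> sets borel" by measurable
  have I: "emeasure lborel {s \<in> {0..1}. linepath x y s \<in> ?F \<inter> ?H} = ennreal (segment_cdf (x \<bullet> u) (y \<bullet> u) t)"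
    if "closed_segment x y \<subseteq> ?F" for x y
  proof -
    have "{s \<in> {0..1}. linepath x y s \<in> ?F \<inter> ?H} = {s \<in> {0..1}. (1 - s) * (x \<bullet> u) + s * (y \<bullet> u) \<le> t}"
      using that by (auto simp: linepath_def inner_add_left linepath_in_path[unfolded linepath_def] subset_iff)
    moreover have "emeasure lborel {s \<in> {0..1}. (1 - s) * (x \<bullet> u) + s * (y \<bullet> u) \<le> t} \<le> emeasure lborel {0..1::real}"
      by (intro emeasure_mono) auto
    ultimately show ?thesis
      unfolding segment_cdf_def by (subst emeasure_eq_ennreal_measure) (auto simp: top_unique)
  qed
  have "emeasure ?m (?F \<inter> ?H) = ennreal (dist a b) * ennreal (segment_cdf (a \<bullet> u) (b \<bullet> u) t) +
    ennreal (dist b c) * ennreal (segment_cdf (b \<bullet> u) (c \<bullet> u) t) +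
    ennreal (dist c a) * ennreal (segment_cdf (c \<bullet> u) (a \<bullet> u) t)"
    unfolding emeasure_arc_length_triangle_path[OF sets.Int[OF sets_frontier_triangle H]]
    by (subst (1 2 3) I) (auto simp: frontier_of_triangle)
  also have "\<dots> = ennreal (dist a b * segment_cdf (a \<bullet> u) (b \<bullet> u) t + dist b c * segment_cdf (b \<bullet> u) (c \<bullet> u) t +
     dist c a * segment_cdf (c \<bullet> u) (a \<bullet> u) t)"
    by (simp add: nn ennreal_mult)
  finally have "measure ?m (?F \<inter> ?H) = dist a b * segment_cdf (a \<bullet> u) (b \<bullet> u) t + dist b c * segment_cdf (b \<bullet> u) (c \<bullet> u) t +
     dist c a * segment_cdf (c \<bullet> u) (a \<bullet> u) t"
    by (intro measure_eq_emeasure_eq_ennreal add_nonneg_nonneg mult_nonneg_nonneg nn zero_le_dist)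
  moreover have "measure ?m ?F = dist a b + dist b c + dist c a"
    by (intro measure_eq_emeasure_eq_ennreal emeasure_arc_length_triangle add_nonneg_nonneg zero_le_dist)
  ultimately show ?thesis
    unfolding uniform_on_boundary_def boundary_cdf_def using perimeter_pos H
    by (subst measure_uniform_measure) (simp_all add: emeasure_arc_length_triangle del: ennreal_plus)
qed

end

subsection \<open>Comparison of the two distributions\<close>

text \<open>The one-dimensional inequality with normalized side lengths as weights: ab and bc
  project onto the intervals on either side of \<open>b \<bullet> u\<close>, and ca projects onto
  their union. The weight conditions are triangle inequalities.\<close>

lemma nn_integral_abs_proj_sorted_le:
  fixes a b c u :: "real^2"
  assumes nc: "\<not> collinear {a, b, c}" and u: "u \<noteq> 0" and le: "a \<bullet> u \<le> b \<bullet> u" "b \<bullet> u \<le> c \<bullet> u"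
  shows "(\<integral>\<^sup>+x. \<integral>\<^sup>+y. ennreal \<bar>x \<bullet> u - y \<bullet> u\<bar> \<partial>uniform_in (convex hull {a, b, c}) \<partial>uniform_in (convex hull {a, b, c}))
    \<le> (\<integral>\<^sup>+t. ennreal (2 * (boundary_cdf a b c u t * (1 - boundary_cdf a b c u t))) \<partial>lborel)"
proof -
  let ?K = "convex hull {a, b, c}"
  interpret prob_space "uniform_in ?K" by (rule prob_space_uniform_in_triangle[OF nc])
  have [simp]: "space (uniform_in ?K) = UNIV" by (simp add: uniform_in_def)
  have [measurable_cong]: "sets (uniform_in ?K) = sets borel" by (simp add: uniform_in_def)
  define L where "L = dist a b + dist b c + dist c a"
  have L: "0 < L" using perimeter_pos[OF nc] by (simp add: L_def)
  \<comment> \<open>Equal extreme projections would put all three vertices on a line perpendicular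
    to u.\<close>
  have "a \<bullet> u \<noteq> c \<bullet> u"
  proof
    assume "a \<bullet> u = c \<bullet> u"
    then have "{a, b, c} \<subseteq> {z. u \<bullet> z = a \<bullet> u}" using le by (auto simp: inner_commute)
    then have "aff_dim {a, b, c} \<le> aff_dim {z. u \<bullet> z = a \<bullet> u}" by (rule aff_dim_subset)
    with nc show False using u by (simp add: collinear_aff_dim)
  qed
  then have lt: "a \<bullet> u < c \<bullet> u" using le by simp
  have "(\<integral>\<^sup>+x. \<integral>\<^sup>+y. ennreal \<bar>x \<bullet> u - y \<bullet> u\<bar> \<partial>uniform_in ?K \<partial>uniform_in ?K) =
    (\<integral>\<^sup>+t. ennreal (2 * (prob {z. z \<bullet> u \<le> t} * (1 - prob {z. z \<bullet> u \<le> t}))) \<partial>lborel)"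
    by (subst nn_integral_abs_diff_eq_cdf) simp_all
  also have "\<dots> \<le> (\<integral>\<^sup>+t. ennreal (2 * (boundary_cdf a b c u t * (1 - boundary_cdf a b c u t))) \<partial>lborel)"
  proof (rule nn_integral_tent_cdf_le[where p = "a \<bullet> u" and q = "b \<bullet> u" and r = "c \<bullet> u"
        and \<alpha> = "dist a b / L" and \<beta> = "dist b c / L" and w = "dist c a / L"])
    show "dist a b / L \<le> dist b c / L + dist c a / L" "dist b c / L \<le> dist a b / L + dist c a / L"
      using dist_triangle[of a b c] dist_triangle[of b c a] L
      by (simp_all add: add_divide_distrib[symmetric] divide_right_mono dist_commute)
    show "dist a b / L + dist b c / L + dist c a / L = 1"
      using L by (simp add: add_divide_distrib[symmetric] L_def[symmetric])
    \<comment> \<open>To the left of the middle projection the side bc has not been reached yet; to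
      its right the side ab is exhausted.\<close>
    show "boundary_cdf a b c u t = (dist c a / L / (c \<bullet> u - a \<bullet> u) + dist a b / L / (b \<bullet> u - a \<bullet> u)) * (t - a \<bullet> u)"
      if "a \<bullet> u < t" "t < b \<bullet> u" for t
    proof -
      have "segment_cdf (c \<bullet> u) (a \<bullet> u) t = (t - a \<bullet> u) / (c \<bullet> u - a \<bullet> u)"
        using that le by (subst segment_cdf_commute) (auto intro: segment_cdf_between)
      then show ?thesis
        unfolding boundary_cdf_def L_def[symmetric]
        using that le by (simp add: segment_cdf_between segment_cdf_eq_0 add_divide_distrib distrib_left mult.commute)
    qed
    show "1 - boundary_cdf a b c u t = (dist c a / L / (c \<bullet> u - a \<bullet> u) + dist b c / L / (c \<bullet> u - b \<bullet> u)) * (c \<bullet> u - t)"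
      if "b \<bullet> u < t" "t < c \<bullet> u" for t
    proof -
      have 1: "segment_cdf (c \<bullet> u) (a \<bullet> u) t = 1 - (c \<bullet> u - t) / (c \<bullet> u - a \<bullet> u)"
        using that le by (subst segment_cdf_commute, subst segment_cdf_between) (auto simp: field_simps)
      have 2: "segment_cdf (b \<bullet> u) (c \<bullet> u) t = 1 - (c \<bullet> u - t) / (c \<bullet> u - b \<bullet> u)"
        using that le by (subst segment_cdf_between) (auto simp: field_simps)
      have 3: "segment_cdf (a \<bullet> u) (b \<bullet> u) t = 1"
        using that le by (intro segment_cdf_eq_1) auto
      have "1 - boundary_cdf a b c u t = (L - (dist a b * 1 + dist b c * (1 - (c \<bullet> u - t) / (c \<bullet> u - b \<bullet> u)) +
         dist c a * (1 - (c \<bullet> u - t) / (c \<bullet> u - a \<bullet> u)))) / L"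
        using L unfolding boundary_cdf_def 1 2 3 L_def[symmetric] by (simp add: diff_divide_distrib)
      also have "L - (dist a b * 1 + dist b c * (1 - (c \<bullet> u - t) / (c \<bullet> u - b \<bullet> u)) +
         dist c a * (1 - (c \<bullet> u - t) / (c \<bullet> u - a \<bullet> u))) =
         (dist c a / (c \<bullet> u - a \<bullet> u) + dist b c / (c \<bullet> u - b \<bullet> u)) * (c \<bullet> u - t)"
        by (simp add: L_def algebra_simps)
      finally show ?thesis by (simp add: add_divide_distrib algebra_simps)
    qed
  qed (use le lt L uniform_in_triangle_cdf[OF nc u le] in auto)
  finally show ?thesis .
qed

text \<open>Reduction to vertices sorted by projection: \<mu> depends only on the set of vertices,
  and the right side, once expressed by \<open>boundary_cdf\<close>, is the same for every
  order.\<close>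

lemma nn_integral_abs_proj_le:
  fixes a b c u :: "real^2"
  assumes nc: "\<not> collinear {a, b, c}"
  defines "\<mu> \<equiv> uniform_in (convex hull {a, b, c})" and "\<nu> \<equiv> uniform_on_boundary a b c"
  shows "(\<integral>\<^sup>+x. \<integral>\<^sup>+y. ennreal \<bar>x \<bullet> u - y \<bullet> u\<bar> \<partial>\<mu> \<partial>\<mu>) \<le> (\<integral>\<^sup>+x. \<integral>\<^sup>+y. ennreal \<bar>x \<bullet> u - y \<bullet> u\<bar> \<partial>\<nu> \<partial>\<nu>)"
proof (cases "u = 0")
  case False
  interpret N: prob_space \<nu> unfolding \<nu>_def by (rule prob_space_uniform_on_boundary[OF nc])
  have sets [measurable_cong]: "sets \<nu> = sets borel" by (simp add: \<nu>_def sets_uniform_on_boundary)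
  have [simp]: "space \<nu> = UNIV" using sets_eq_imp_space_eq[OF sets] by simp
  have "(\<integral>\<^sup>+x. \<integral>\<^sup>+y. ennreal \<bar>x \<bullet> u - y \<bullet> u\<bar> \<partial>\<mu> \<partial>\<mu>)
    \<le> (\<integral>\<^sup>+t. ennreal (2 * (boundary_cdf a b c u t * (1 - boundary_cdf a b c u t))) \<partial>lborel)"
  proof -
    have *: ?thesis
      if "{x, y, z} = {a, b, c}" "boundary_cdf x y z = boundary_cdf a b c" "x \<bullet> u \<le> y \<bullet> u" "y \<bullet> u \<le> z \<bullet> u" for x y z
      using nn_integral_abs_proj_sorted_le[of x y z u] that False nc by (simp add: \<mu>_def)
    have rot: "boundary_cdf b c a = boundary_cdf a b c" "boundary_cdf c a b = boundary_cdf a b c"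
      by (metis boundary_cdf_rotate)+
    have swap: "boundary_cdf c b a = boundary_cdf a b c" "boundary_cdf b a c = boundary_cdf a b c" "boundary_cdf a c b = boundary_cdf a b c"
      by (metis boundary_cdf_rotate boundary_cdf_swap)+
    consider "a \<bullet> u \<le> b \<bullet> u" "b \<bullet> u \<le> c \<bullet> u" | "a \<bullet> u \<le> c \<bullet> u" "c \<bullet> u \<le> b \<bullet> u"
      | "b \<bullet> u \<le> a \<bullet> u" "a \<bullet> u \<le> c \<bullet> u" | "b \<bullet> u \<le> c \<bullet> u" "c \<bullet> u \<le> a \<bullet> u"
      | "c \<bullet> u \<le> a \<bullet> u" "a \<bullet> u \<le> b \<bullet> u" | "c \<bullet> u \<le> b \<bullet> u" "b \<bullet> u \<le> a \<bullet> u"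
      by linarith
    then show ?thesis
    proof cases
      case 1 then show ?thesis by (intro *[of a b c]) (auto simp: rot swap)
    next
      case 2 then show ?thesis by (intro *[of a c b]) (auto simp: rot swap)
    next
      case 3 then show ?thesis by (intro *[of b a c]) (auto simp: rot swap)
    next
      case 4 then show ?thesis by (intro *[of b c a]) (auto simp: rot swap)
    next
      case 5 then show ?thesis by (intro *[of c a b]) (auto simp: rot swap)
    next
      case 6 then show ?thesis by (intro *[of c b a]) (auto simp: rot swap)
    qed
  qed
  also have "\<dots> = (\<integral>\<^sup>+x. \<integral>\<^sup>+y. ennreal \<bar>x \<bullet> u - y \<bullet> u\<bar> \<partial>\<nu> \<partial>\<nu>)"
  proof -
    have cdf: "N.prob {x \<in> space \<nu>. x \<bullet> u \<le> t} = boundary_cdf a b c u t" for t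
      using uniform_on_boundary_cdf[OF nc, of u t] by (simp add: \<nu>_def[symmetric])
    have "(\<lambda>x. x \<bullet> u) \<in> borel_measurable \<nu>" by measurable
    then show ?thesis by (simp only: N.nn_integral_abs_diff_eq_cdf cdf)
  qed
  finally show ?thesis .
qed simp

text \<open>The half-circle identity for z = x - y, whose constant is the factor 2, is integrated
  over both copies; two applications of Tonelli move the angle to the outside.\<close>

lemma nn_integral_norm_diff_eq_directions:
  assumes "sigma_finite_measure M" and sets: "sets M = sets (borel :: (real^2) measure)"
  shows "2 * (\<integral>\<^sup>+x. \<integral>\<^sup>+y. ennreal (dist x y) \<partial>M \<partial>M) =
    (\<integral>\<^sup>+\<theta>. (\<integral>\<^sup>+x. \<integral>\<^sup>+y. ennreal \<bar>x \<bullet> vector [cos \<theta>, sin \<theta>] - y \<bullet> vector [cos \<theta>, sin \<theta>]\<bar> \<partial>M \<partial>M) *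
       indicator {0..pi} \<theta> \<partial>lborel)"
proof -
  note [measurable_cong] = sets
  interpret M: sigma_finite_measure M by fact
  interpret L: pair_sigma_finite M lborel ..
  let ?e = "\<lambda>\<theta>::real. vector [cos \<theta>, sin \<theta>] :: real^2"
  let ?g = "\<lambda>x y \<theta>. ennreal \<bar>x \<bullet> ?e \<theta> - y \<bullet> ?e \<theta>\<bar> * indicator {0..pi} \<theta>"
  \<comment> \<open>Continuity in the angle supplies the joint measurability that Tonelli
    requires.\<close>
  have "continuous_on UNIV ?e"
  proof -
    have "?e = (\<lambda>\<theta>. cos \<theta> *\<^sub>R axis 1 1 + sin \<theta> *\<^sub>R axis 2 1)"
      by (simp add: fun_eq_iff vec_eq_iff forall_2 axis_def)
    then show ?thesis by (simp only:) (intro continuous_intros)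
  qed
  then have e [measurable]: "?e \<in> borel_measurable borel"
    by (rule borel_measurable_continuous_onI)
  have "2 * (\<integral>\<^sup>+x. \<integral>\<^sup>+y. ennreal (dist x y) \<partial>M \<partial>M) = (\<integral>\<^sup>+x. \<integral>\<^sup>+y. ennreal (2 * norm (x - y)) \<partial>M \<partial>M)"
    by (simp add: dist_norm ennreal_mult nn_integral_cmult)
  also have "\<dots> = (\<integral>\<^sup>+x. \<integral>\<^sup>+y. \<integral>\<^sup>+\<theta>. ?g x y \<theta> \<partial>lborel \<partial>M \<partial>M)"
    by (simp only: nn_integral_abs_inner_circle[symmetric] inner_diff_left)
  also have "\<dots> = (\<integral>\<^sup>+x. \<integral>\<^sup>+\<theta>. \<integral>\<^sup>+y. ?g x y \<theta> \<partial>M \<partial>lborel \<partial>M)"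
    by (intro nn_integral_cong L.Fubini'[symmetric]) measurable
  also have "\<dots> = (\<integral>\<^sup>+\<theta>. \<integral>\<^sup>+x. \<integral>\<^sup>+y. ?g x y \<theta> \<partial>M \<partial>M \<partial>lborel)"
    by (intro L.Fubini'[symmetric]) measurable
  also have "\<dots> = (\<integral>\<^sup>+\<theta>. (\<integral>\<^sup>+x. \<integral>\<^sup>+y. ennreal \<bar>x \<bullet> ?e \<theta> - y \<bullet> ?e \<theta>\<bar> \<partial>M \<partial>M) * indicator {0..pi} \<theta> \<partial>lborel)"
    by (intro nn_integral_cong) (simp split: split_indicator)
  finally show ?thesis .
qed

text \<open>The projection inequality holds at every angle and is integrated over half a turn; the
  finite nonzero factor 2 cancels.\<close>

lemma nn_integral_dist_le:
  fixes a b c :: "real^2"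
  assumes nc: "\<not> collinear {a, b, c}"
  defines "\<mu> \<equiv> uniform_in (convex hull {a, b, c})" and "\<nu> \<equiv> uniform_on_boundary a b c"
  shows "(\<integral>\<^sup>+x. \<integral>\<^sup>+y. ennreal (dist x y) \<partial>\<mu> \<partial>\<mu>) \<le> (\<integral>\<^sup>+x. \<integral>\<^sup>+y. ennreal (dist x y) \<partial>\<nu> \<partial>\<nu>)"
proof -
  interpret M: prob_space \<mu> unfolding \<mu>_def by (rule prob_space_uniform_in_triangle[OF nc])
  interpret N: prob_space \<nu> unfolding \<nu>_def by (rule prob_space_uniform_on_boundary[OF nc])
  have sets: "sets \<mu> = sets borel" "sets \<nu> = sets borel"
    by (simp_all add: \<mu>_def \<nu>_def uniform_in_def sets_uniform_on_boundary)
  have "2 * (\<integral>\<^sup>+x. \<integral>\<^sup>+y. ennreal (dist x y) \<partial>\<mu> \<partial>\<mu>) \<le> 2 * (\<integral>\<^sup>+x. \<integral>\<^sup>+y. ennreal (dist x y) \<partial>\<nu> \<partial>\<nu>)"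
    using nn_integral_abs_proj_le[OF nc, folded \<mu>_def \<nu>_def]
    unfolding nn_integral_norm_diff_eq_directions[OF M.sigma_finite_measure_axioms sets(1)]
      nn_integral_norm_diff_eq_directions[OF N.sigma_finite_measure_axioms sets(2)]
    by (intro nn_integral_mono mult_right_mono) auto
  then show ?thesis
    by (simp add: ennreal_mult_le_mult_iff)
qed

section \<open>Expectations of independent copies as iterated integrals\<close>

lemma (in prob_space) expectation_indep_eq:
  fixes f :: "'b::topological_space \<Rightarrow> 'b \<Rightarrow> real"
  assumes "indep_var borel X borel X'" "distr M borel X = \<mu>" "distr M borel X' = \<mu>"
    and f: "case_prod f \<in> borel_measurable (borel \<Otimes>\<^sub>M borel)" "\<And>x y. 0 \<le> f x y"
  shows "expectation (\<lambda>\<omega>. f (X \<omega>) (X' \<omega>)) = enn2real (\<integral>\<^sup>+x. \<integral>\<^sup>+y. ennreal (f x y) \<partial>\<mu> \<partial>\<mu>)"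
proof -
  have X: "X \<in> measurable M borel" "X' \<in> measurable M borel"
    and d: "\<mu> \<Otimes>\<^sub>M \<mu> = distr M (borel \<Otimes>\<^sub>M borel) (\<lambda>\<omega>. (X \<omega>, X' \<omega>))"
    using assms(1-3) by (auto simp: indep_var_distribution_eq)
  interpret mu: prob_space \<mu>
    unfolding assms(2)[symmetric] by (rule prob_space_distr[OF X(1)])
  have sets [measurable_cong]: "sets \<mu> = sets borel" unfolding assms(2)[symmetric] by simp
  note [measurable] = X f(1)
  have P: "(\<lambda>\<omega>. (X \<omega>, X' \<omega>)) \<in> measurable M (borel \<Otimes>\<^sub>M borel)" by measurable
  have fm: "(\<lambda>z. ennreal (case_prod f z)) \<in> borel_measurable (borel \<Otimes>\<^sub>M borel)" by measurable
  have "(\<lambda>\<omega>. case_prod f (X \<omega>, X' \<omega>)) \<in> borel_measurable M"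
    by (rule measurable_compose[OF P f(1)])
  \<comment> \<open>For nonnegative integrands this holds without integrability: an infinite
    integral gives 0 on both sides.\<close>
  then have "expectation (\<lambda>\<omega>. f (X \<omega>) (X' \<omega>)) = enn2real (\<integral>\<^sup>+\<omega>. ennreal (f (X \<omega>) (X' \<omega>)) \<partial>M)"
    using f(2) by (intro integral_eq_nn_integral) auto
  also have "(\<integral>\<^sup>+\<omega>. ennreal (f (X \<omega>) (X' \<omega>)) \<partial>M) = (\<integral>\<^sup>+z. ennreal (case_prod f z) \<partial>(\<mu> \<Otimes>\<^sub>M \<mu>))"
    unfolding d using fm by (subst nn_integral_distr[OF P]) simp_all
  also have "\<dots> = (\<integral>\<^sup>+x. \<integral>\<^sup>+y. ennreal (f x y) \<partial>\<mu> \<partial>\<mu>)"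
    using fm by (subst mu.nn_integral_fst[symmetric]) (simp_all cong: measurable_cong_sets sets_pair_measure_cong add: sets)
  finally show ?thesis .
qed

text \<open>\<open>enn2real\<close> sends infinity to 0, so it preserves an inequality only if the
  larger side is finite. Boundary points lie almost surely in the compact triangle, whose diameter
  bounds their distance.\<close>

lemma nn_integral_dist_boundary_finite:
  fixes a b c :: "real^2"
  assumes nc: "\<not> collinear {a, b, c}"
  defines "\<nu> \<equiv> uniform_on_boundary a b c"
  shows "(\<integral>\<^sup>+x. \<integral>\<^sup>+y. ennreal (dist x y) \<partial>\<nu> \<partial>\<nu>) < \<infinity>"
proof -
  interpret N: prob_space \<nu> unfolding \<nu>_def by (rule prob_space_uniform_on_boundary[OF nc])
  let ?K = "convex hull {a, b, c}"
  have AE: "AE z in \<nu>. z \<in> ?K" unfolding \<nu>_def by (rule AE_uniform_on_boundary[OF nc])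
  have bd: "dist x y \<le> diameter ?K" if "x \<in> ?K" "y \<in> ?K" for x y
    using that by (intro diameter_bounded_bound compact_imp_bounded compact_triangle)
  have "(\<integral>\<^sup>+x. \<integral>\<^sup>+y. ennreal (dist x y) \<partial>\<nu> \<partial>\<nu>) \<le> (\<integral>\<^sup>+x. \<integral>\<^sup>+y. ennreal (diameter ?K) \<partial>\<nu> \<partial>\<nu>)"
    using AE
  proof (intro nn_integral_mono_AE, eventually_elim)
    case (elim x)
    show ?case
      using AE by (intro nn_integral_mono_AE, eventually_elim) (simp add: bd elim ennreal_leI)
  qed
  also have "\<dots> < \<infinity>" by (simp add: N.emeasure_space_1)
  finally show ?thesis .
qed

theorem theorem5:
  fixes a b c :: "real^2" and K :: "(real^2) set"
    and M :: "'w measure" and X X' Y Y' :: "'w \<Rightarrow> real^2"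
  assumes "\<not> collinear {a, b, c}" and "K = convex hull {a, b, c}"
    and "prob_space M"
    and "prob_space.indep_var M borel X borel X'"
    and "distr M borel X = uniform_in K" and "distr M borel X' = uniform_in K"
    and "prob_space.indep_var M borel Y borel Y'"
    and "distr M borel Y = uniform_on_boundary a b c"
    and "distr M borel Y' = uniform_on_boundary a b c"
  shows "(\<forall>u. norm u = 1 \<longrightarrow>
            prob_space.expectation M (\<lambda>\<omega>. \<bar>proj u (X \<omega>) - proj u (X' \<omega>)\<bar>)
              \<le> prob_space.expectation M (\<lambda>\<omega>. \<bar>proj u (Y \<omega>) - proj u (Y' \<omega>)\<bar>))
         \<and> prob_space.expectation M (\<lambda>\<omega>. dist (X \<omega>) (X' \<omega>))
              \<le> prob_space.expectation M (\<lambda>\<omega>. dist (Y \<omega>) (Y' \<omega>))"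
proof (intro conjI allI impI)
  interpret prob_space M by fact
  let ?\<nu> = "uniform_on_boundary a b c"
  note X = expectation_indep_eq[OF assms(4-6)] and Y = expectation_indep_eq[OF assms(7-9)]
  note fin = nn_integral_dist_boundary_finite[OF assms(1)]
  have "(\<lambda>(x, y). dist x y) \<in> borel_measurable (borel \<Otimes>\<^sub>M (borel :: (real^2) measure))"
    by measurable
  note XY = X[OF this zero_le_dist] Y[OF this zero_le_dist]
  show "expectation (\<lambda>\<omega>. dist (X \<omega>) (X' \<omega>)) \<le> expectation (\<lambda>\<omega>. dist (Y \<omega>) (Y' \<omega>))"
    unfolding XY assms(2) using fin
    by (intro enn2real_mono nn_integral_dist_le[OF assms(1)]) simp
  fix u :: "real^2" assume u: "norm u = 1"
  have "(\<lambda>(x, y). \<bar>proj u x - proj u y\<bar>) \<in> borel_measurable (borel \<Otimes>\<^sub>M borel)"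
    unfolding proj_def by measurable
  note XY = X[OF this abs_ge_zero] Y[OF this abs_ge_zero]
  \<comment> \<open>As \<open>norm u = 1\<close>, Cauchy-Schwarz bounds projected distances by
    distances, so the boundary side of the projection inequality is finite as well.\<close>
  have "(\<integral>\<^sup>+x. \<integral>\<^sup>+y. ennreal \<bar>proj u x - proj u y\<bar> \<partial>?\<nu> \<partial>?\<nu>) \<le> (\<integral>\<^sup>+x. \<integral>\<^sup>+y. ennreal (dist x y) \<partial>?\<nu> \<partial>?\<nu>)"
  proof (intro nn_integral_mono ennreal_leI)
    fix x y :: "real^2"
    show "\<bar>proj u x - proj u y\<bar> \<le> dist x y"
      using Cauchy_Schwarz_ineq2[of "x - y" u] u by (simp add: proj_def dist_norm inner_diff_left)
  qed
  also note fin
  finally show "expectation (\<lambda>\<omega>. \<bar>proj u (X \<omega>) - proj u (X' \<omega>)\<bar>) \<le> expectation (\<lambda>\<omega>. \<bar>proj u (Y \<omega>) - proj u (Y' \<omega>)\<bar>)"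
    unfolding XY assms(2)
    by (intro enn2real_mono) (simp_all add: proj_def nn_integral_abs_proj_le[OF assms(1)])
qed

end
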